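(* Let $(X,d)$ be a complete (proper geodesic) metric space with Busemann curvature bounded below by $1$. If $(X,d)$ is not $1$-dimensional, then the diameter of $X$ is at most $\pi$.
   Context: A metric space is proper if closed bounded subsets are compact, and geodesic if any two points are joined by a unit speed geodesic. Here a unit speed geodesic of length $a$ is a map $\gamma:[0,a]\to X$, $s\mapsto\gamma_s$, with $d(\gamma_s,\gamma_t)=|s-t|$. $S^2$ is the round unit sphere with its intrinsic metric $d_{S^2}$. $(X,d)$ has Busemann curvature bounded below by $1$ if the following holds. Let $\gamma,\eta,\xi$ be unit speed geodesics in $X$ of lengths $a,b,c\ge0$ with $\gamma_0=\eta_0$, $\gamma_a=\xi_0$, $\eta_b=\xi_c$, such that there is a comparison triangle in $S^2$, i.e. unit speed geodesics $\tilde\gamma,\tilde\eta,\tilde\xi$ in $S^2$ of lengths $a,b,c$ with $\tilde\gamma_0=\tilde\eta_0$, $\tilde\gamma_a=\tilde\xi_0$, $\tilde\eta_b=\tilde\xi_c$ (such a triangle exists if $a,b,c\le\pi$ and $a+b+c\le2\pi$). Then $$d(\gamma_{ta},\eta_{tb})\ge d_{S^2}(\tilde\gamma_{ta},\tilde\eta_{tb})\quad\text{for all }t\in[0,1].$$ (If all lengths are $<\pi$ the comparison triangle is unique up to isometry; in degenerate cases where it is not unique, the inequality is required for some comparison triangle.) A geodesic metric space is not $1$-dimensional if for every unit speed geodesic $\gamma:[0,a]\to X$ ($a>0$) and every $\epsilon>0$ there is a point $y$ in the open ball $B_a(\gamma_0)$ with $d(\gamma_a,y)<\epsilon$ and $y\notin\gamma([0,a])$.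 *)

theory Defs
  imports "HOL-Analysis.Analysis"
begin

text \<open>Geodesics are needed both in the ambient space (a type of class
  \<^class>\<open>metric_space\<close>) and in the round sphere, a subset of Euclidean space carrying a
  metric that is not the restriction of \<^const>\<open>dist\<close>; hence the explicit carrier and distance.
  Values of \<open>\<gamma>\<close> outside \<open>{0..a}\<close> are irrelevant.\<close>

definition unit_speed_geodesic ::
  "'p set \<Rightarrow> ('p \<Rightarrow> 'p \<Rightarrow> real) \<Rightarrow> real \<Rightarrow> (real \<Rightarrow> 'p) \<Rightarrow> bool" where
  "unit_speed_geodesic M d a \<gamma> \<longleftrightarrow>
     0 \<le> a \<and> \<gamma> ` {0..a} \<subseteq> M \<and> (\<forall>s\<in>{0..a}. \<forall>t\<in>{0..a}. d (\<gamma> s) (\<gamma> t) = \<bar>s - t\<bar>)"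

definition geodesic_triangle ::
  "'p set \<Rightarrow> ('p \<Rightarrow> 'p \<Rightarrow> real) \<Rightarrow> real \<Rightarrow> real \<Rightarrow> real \<Rightarrow>
   (real \<Rightarrow> 'p) \<Rightarrow> (real \<Rightarrow> 'p) \<Rightarrow> (real \<Rightarrow> 'p) \<Rightarrow> bool" where
  "geodesic_triangle M d a b c \<gamma> \<eta> \<xi> \<longleftrightarrow>
     unit_speed_geodesic M d a \<gamma> \<and> unit_speed_geodesic M d b \<eta> \<and> unit_speed_geodesic M d c \<xi> \<and>
     \<gamma> 0 = \<eta> 0 \<and> \<gamma> a = \<xi> 0 \<and> \<eta> b = \<xi> c"

definition S2 :: "(real ^ 3) set" where
  "S2 = sphere 0 1"

text \<open>The intrinsic (great-circle) distance of unit vectors is the angle between them.\<close>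

definition dist_S2 :: "real ^ 3 \<Rightarrow> real ^ 3 \<Rightarrow> real" where
  "dist_S2 x y = arccos (x \<bullet> y)"

definition proper_space :: "'a::metric_space itself \<Rightarrow> bool" where
  "proper_space _ \<longleftrightarrow> (\<forall>S :: 'a set. closed S \<and> bounded S \<longrightarrow> compact S)"

definition geodesic_space :: "'a::metric_space itself \<Rightarrow> bool" where
  "geodesic_space _ \<longleftrightarrow>
     (\<forall>x y :: 'a. \<exists>a \<gamma>. unit_speed_geodesic UNIV dist a \<gamma> \<and> \<gamma> 0 = x \<and> \<gamma> a = y)"

text \<open>The comparison triangle is unique up to isometry if all lengths are less than \<open>\<pi>\<close>. In the
  degenerate cases where it is not, the inequality is required for some comparison triangle,
  the same one for all \<open>t\<close>. If there is no comparison triangle, nothing is required.\<close>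

definition busemann_curvature_ge_1 :: "'a::metric_space itself \<Rightarrow> bool" where
  "busemann_curvature_ge_1 _ \<longleftrightarrow>
     (\<forall>a b c. \<forall>(\<gamma> :: real \<Rightarrow> 'a) \<eta> \<xi>.
        geodesic_triangle UNIV dist a b c \<gamma> \<eta> \<xi> \<longrightarrow>
        (\<exists>\<gamma>' \<eta>' \<xi>'. geodesic_triangle S2 dist_S2 a b c \<gamma>' \<eta>' \<xi>') \<longrightarrow>
        (\<exists>\<gamma>' \<eta>' \<xi>'. geodesic_triangle S2 dist_S2 a b c \<gamma>' \<eta>' \<xi>' \<and>
           (\<forall>t\<in>{0..1}. dist (\<gamma> (t * a)) (\<eta> (t * b)) \<ge> dist_S2 (\<gamma>' (t * a)) (\<eta>' (t * b)))))"

definition not_one_dimensional :: "'a::metric_space itself \<Rightarrow> bool" where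
  "not_one_dimensional _ \<longleftrightarrow>
     (\<forall>a > 0. \<forall>\<gamma> :: real \<Rightarrow> 'a. unit_speed_geodesic UNIV dist a \<gamma> \<longrightarrow>
        (\<forall>\<epsilon> > 0. \<exists>y \<in> ball (\<gamma> 0) a. dist (\<gamma> a) y < \<epsilon> \<and> y \<notin> \<gamma> ` {0..a}))"

end

theory Submission imports Defs begin

text \<open>Equality of comparison points forces equality of the ends of an isosceles triangle, so
  geodesics do not branch. Suppose \<open>g\<close> is a geodesic on \<open>[-\<delta>, \<pi> + \<delta>]\<close>, and let \<open>y\<close> be a
  point off \<open>g\<close>, close to \<open>g \<pi>\<close>, with \<open>b = d(g 0, y) < \<pi>\<close>. The perimeter of the triangle
  \<open>g 0, g a, y\<close> is \<open>< 2 \<pi>\<close> for \<open>a = 0\<close> and \<open>\<ge> 2 \<pi>\<close> for \<open>a = \<pi>\<close>; take the largest \<open>a\<close> at which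
  it equals \<open>2 \<pi>\<close>. The comparison triangle is then a great circle, so that \<open>g\<close> arriving at \<open>g a\<close>
  is continued by the side from \<open>g a\<close> to \<open>y\<close>. As geodesics do not branch, this side
  starts along \<open>g\<close>, which keeps the perimeter at \<open>2 \<pi>\<close> for a larger \<open>a\<close>. The degenerate cases, where
  \<open>y\<close> lies between \<open>g 0\<close> and \<open>g \<pi>\<close> or \<open>g 0\<close> lies between \<open>g a\<close> and \<open>y\<close>, contradict
  non-branching of \<open>g\<close> at \<open>g \<pi>\<close> and at \<open>g 0\<close>.\<close>

section \<open>Geodesics of the round sphere\<close>

lemma sphere_geodesic_inner:
  assumes "unit_speed_geodesic S2 dist_S2 a \<gamma>" "s \<in> {0..a}" "t \<in> {0..a}"
  shows "\<gamma> s \<bullet> \<gamma> t = cos (s - t)"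
proof -
  have "\<gamma> s \<in> S2" "\<gamma> t \<in> S2" and d: "arccos (\<gamma> s \<bullet> \<gamma> t) = \<bar>s - t\<bar>"
    using assms by (auto simp: unit_speed_geodesic_def dist_S2_def)
  then have "\<bar>\<gamma> s \<bullet> \<gamma> t\<bar> \<le> 1"
    using Cauchy_Schwarz_ineq2[of "\<gamma> s" "\<gamma> t"] by (simp add: S2_def)
  then have "cos \<bar>s - t\<bar> = \<gamma> s \<bullet> \<gamma> t"
    unfolding d[symmetric] by (rule cos_arccos_abs)
  then show ?thesis by simp
qed

text \<open>The inner products are those of planar unit vectors at angles 0, \<open>p\<close> and
  \<open>p + q\<close>, so the Gram matrix is singular. The relation is checked by computing that
  the difference of both sides has norm zero.\<close>

lemma coplanar_if_angles_add:
  fixes u v w :: "'b::real_inner"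
  assumes "u \<bullet> u = 1" "v \<bullet> v = 1" "w \<bullet> w = 1"
    and "u \<bullet> v = cos p" "v \<bullet> w = cos q" "u \<bullet> w = cos (p + q)"
  shows "sin (p + q) *\<^sub>R v = sin q *\<^sub>R u + sin p *\<^sub>R w"
proof -
  let ?z = "sin (p + q) *\<^sub>R v - (sin q *\<^sub>R u + sin p *\<^sub>R w)"
  have "?z \<bullet> ?z = (sin (p + q))\<^sup>2 + (sin q)\<^sup>2 + (sin p)\<^sup>2 - 2 * sin (p + q) * sin q * cos p
      - 2 * sin (p + q) * sin p * cos q + 2 * sin q * sin p * cos (p + q)"
    using assms
    by (simp add: inner_diff_left inner_diff_right inner_add_left inner_add_right
        inner_commute[of v u] inner_commute[of w v] inner_commute[of w u]
        power2_eq_square algebra_simps)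
  also have "\<dots> = 0"
    using sin_cos_squared_add[of p] sin_cos_squared_add[of q]
    unfolding sin_add cos_add by algebra
  finally show ?thesis by simp
qed

text \<open>Spherical linear interpolation. Keeping the factor \<open>sin a\<close> avoids a
  division that would fail for \<open>a = 0\<close> and \<open>a = pi\<close>.\<close>

lemma sphere_geodesic_coplanar:
  assumes "unit_speed_geodesic S2 dist_S2 a \<gamma>" "s \<in> {0..a}"
  shows "sin a *\<^sub>R \<gamma> s = sin (a - s) *\<^sub>R \<gamma> 0 + sin s *\<^sub>R \<gamma> a"
proof -
  have i: "\<gamma> r \<bullet> \<gamma> t = cos (r - t)" if "r \<in> {0..a}" "t \<in> {0..a}" for r t
    using sphere_geodesic_inner[OF assms(1)] that .
  have "sin (s + (a - s)) *\<^sub>R \<gamma> s = sin (a - s) *\<^sub>R \<gamma> 0 + sin s *\<^sub>R \<gamma> a"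
    using assms(2) cos_minus[of "a - s"]
    by (intro coplanar_if_angles_add) (simp_all add: i)
  then show ?thesis by simp
qed

text \<open>The interpolation formula at \<open>s\<close> can be solved for the far end, whose
  coefficient \<open>sin s\<close> is nonzero.\<close>

lemma sphere_geodesic_unique:
  assumes "unit_speed_geodesic S2 dist_S2 a \<gamma>" "unit_speed_geodesic S2 dist_S2 a \<eta>"
    and "s \<in> {0..a}" "0 < s" "s < pi" "\<gamma> 0 = \<eta> 0" "\<gamma> s = \<eta> s"
  shows "\<gamma> a = \<eta> a"
proof -
  have "sin s *\<^sub>R \<gamma> a = sin s *\<^sub>R \<eta> a"
    using sphere_geodesic_coplanar[OF assms(1,3)] sphere_geodesic_coplanar[OF assms(2,3)] assms(6,7)
    by (metis add_left_cancel)
  then show ?thesis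
    using sin_gt_zero[OF assms(4,5)] by (metis less_irrefl scaleR_cancel_left)
qed

lemma sphere_arc_geodesic:
  assumes "u \<in> S2" "v \<in> S2" "u \<bullet> v = cos a" "0 < a" "a < pi"
  obtains \<gamma> where "unit_speed_geodesic S2 dist_S2 a \<gamma>" "\<gamma> 0 = u" "\<gamma> a = v"
proof
  \<comment> \<open>The interpolation formula serves as the definition of the arc;
    \<open>\<alpha>\<close> postpones the division by \<open>sin a\<close>, which leaves a
    polynomial identity for the inner products.\<close>
  define \<alpha> where "\<alpha> s = sin (a - s) *\<^sub>R u + sin s *\<^sub>R v" for s
  define \<gamma> where "\<gamma> s = inverse (sin a) *\<^sub>R \<alpha> s" for s
  have sa: "sin a > 0" using assms by (simp add: sin_gt_zero)
  have uv: "u \<bullet> u = 1" "v \<bullet> v = 1" "v \<bullet> u = cos a"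
    using assms by (auto simp: S2_def norm_eq_1 inner_commute)
  have inner: "\<gamma> s \<bullet> \<gamma> t = cos (s - t)" for s t
  proof -
    have "\<alpha> s \<bullet> \<alpha> t
      = sin (a - s) * sin (a - t) + sin s * sin t + cos a * (sin (a - s) * sin t + sin s * sin (a - t))"
      using uv assms(3) by (simp add: \<alpha>_def inner_add_left inner_add_right algebra_simps)
    also have "\<dots> = (sin a)\<^sup>2 * cos (s - t)"
      using sin_cos_squared_add[of a] unfolding sin_diff cos_diff by algebra
    finally show ?thesis
      using sa by (simp add: \<gamma>_def power2_eq_square field_simps)
  qed
  then have "\<gamma> s \<in> S2" for s by (simp add: S2_def norm_eq_1)
  moreover have "arccos (cos (s - t)) = \<bar>s - t\<bar>" if "s \<in> {0..a}" "t \<in> {0..a}" for s t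
    using that assms arccos_cos[of "\<bar>s - t\<bar>"] by auto
  ultimately show "unit_speed_geodesic S2 dist_S2 a \<gamma>"
    using assms inner by (auto simp: unit_speed_geodesic_def dist_S2_def)
  show "\<gamma> 0 = u" "\<gamma> a = v" using sa by (simp_all add: \<gamma>_def \<alpha>_def)
qed

lemma comparison_triangle_exists:
  assumes "u \<in> S2" "v \<in> S2" "w \<in> S2"
    and "u \<bullet> v = cos a" "u \<bullet> w = cos b" "v \<bullet> w = cos c"
    and "0 < a" "a < pi" "0 < b" "b < pi" "0 < c" "c < pi"
  shows "\<exists>\<gamma> \<eta> \<xi>. geodesic_triangle S2 dist_S2 a b c \<gamma> \<eta> \<xi>"
proof -
  obtain \<gamma> where "unit_speed_geodesic S2 dist_S2 a \<gamma>" "\<gamma> 0 = u" "\<gamma> a = v"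
    using sphere_arc_geodesic[of u v a] assms by auto
  moreover obtain \<eta> where "unit_speed_geodesic S2 dist_S2 b \<eta>" "\<eta> 0 = u" "\<eta> b = w"
    using sphere_arc_geodesic[of u w b] assms by auto
  moreover obtain \<xi> where "unit_speed_geodesic S2 dist_S2 c \<xi>" "\<xi> 0 = v" "\<xi> c = w"
    using sphere_arc_geodesic[of v w c] assms by auto
  ultimately show ?thesis unfolding geodesic_triangle_def by metis
qed

lemma isosceles_comparison_triangle_exists:
  assumes "0 < L" "L < pi / 2" "0 < c" "c \<le> 2 * L"
  shows "\<exists>\<gamma> \<eta> \<xi>. geodesic_triangle S2 dist_S2 L L c \<gamma> \<eta> \<xi>"
proof -
  \<comment> \<open>The base points lie on the equator at longitudes \<open>c / 2\<close> and
    \<open>- c / 2\<close>, the apex over longitude 0. \<open>k\<close> is the cosine of its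
    latitude, forced by \<open>k * cos (c / 2) = cos L\<close>; \<open>c \<le> 2 * L\<close> gives
    \<open>k \<le> 1\<close>.\<close>
  define k where "k = cos L / cos (c / 2)"
  have c0: "cos (c / 2) > 0" using assms by (intro cos_gt_zero_pi) auto
  have "cos L \<le> cos (c / 2)" "0 \<le> cos L"
    using assms by (auto intro!: cos_monotone_0_pi_le cos_ge_zero)
  then have "k \<le> 1" "0 \<le> k" using c0 by (auto simp: k_def)
  then have k2: "k\<^sup>2 \<le> 1" by (simp add: power_le_one)
  have kL: "k * cos (c / 2) = cos L" using c0 by (simp add: k_def)
  have cc: "cos c = cos (c / 2) * cos (c / 2) - sin (c / 2) * sin (c / 2)"
    using cos_add[of "c / 2" "c / 2"] by simp
  show ?thesis
    by (rule comparison_triangle_exists[of "vector [k, 0, sqrt (1 - k\<^sup>2)]"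
          "vector [cos (c / 2), sin (c / 2), 0]" "vector [cos (c / 2), - sin (c / 2), 0]"])
      (use assms k2 kL cc in \<open>simp_all add: S2_def norm_eq_1 inner_vec_def sum_3 flip: power2_eq_square\<close>)
qed

text \<open>The vertices lie on the equator at angles 0, \<open>a\<close> and \<open>- b\<close>;
  the arc left over has length \<open>c\<close>.\<close>

lemma great_circle_triangle_exists:
  assumes "0 < a" "a < pi" "0 < b" "b < pi" "0 < c" "c < pi" "a + b + c = 2 * pi"
  shows "\<exists>\<gamma> \<eta> \<xi>. geodesic_triangle S2 dist_S2 a b c \<gamma> \<eta> \<xi>"
proof -
  have "c = 2 * pi - (a + b)" using assms by simp
  then have cc: "cos c = cos a * cos b - sin a * sin b"
    by (simp add: cos_diff cos_add)
  show ?thesis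
    by (rule comparison_triangle_exists[of "vector [1, 0, 0]"
          "vector [cos a, sin a, 0]" "vector [cos b, - sin b, 0]"])
      (use assms cc in \<open>simp_all add: S2_def norm_eq_1 inner_vec_def sum_3 flip: power2_eq_square\<close>)
qed

text \<open>Perimeter \<open>2 * pi\<close> gives \<open>cos c = cos (a + b)\<close>, and the
  midpoints are the normalised sums of the end points. Since \<open>(a + b) / 2 < pi\<close>, the
  path through the common vertex is the shorter arc.\<close>

lemma great_circle_midpoint_dist:
  assumes "geodesic_triangle S2 dist_S2 a b c \<gamma> \<eta> \<xi>"
    and "0 < a" "a < pi" "0 < b" "b < pi" "a + b + c = 2 * pi"
  shows "dist_S2 (\<gamma> (a / 2)) (\<eta> (b / 2)) = (a + b) / 2"
proof -
  have g: "unit_speed_geodesic S2 dist_S2 a \<gamma>" "unit_speed_geodesic S2 dist_S2 b \<eta>"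
    "unit_speed_geodesic S2 dist_S2 c \<xi>"
    and e: "\<gamma> 0 = \<eta> 0" "\<gamma> a = \<xi> 0" "\<eta> b = \<xi> c"
    using assms by (auto simp: geodesic_triangle_def)
  have mid: "(2 * cos (r / 2)) *\<^sub>R \<zeta> (r / 2) = \<zeta> 0 + \<zeta> r"
    if "unit_speed_geodesic S2 dist_S2 r \<zeta>" "0 < r" "r < pi" for r \<zeta>
  proof -
    have "sin r *\<^sub>R \<zeta> (r / 2) = sin (r / 2) *\<^sub>R (\<zeta> 0 + \<zeta> r)"
      using sphere_geodesic_coplanar[OF that(1), of "r / 2"] that by (simp add: algebra_simps)
    moreover have "sin r = sin (r / 2) * (2 * cos (r / 2))"
      using sin_double[of "r / 2"] by simp
    ultimately have "sin (r / 2) *\<^sub>R ((2 * cos (r / 2)) *\<^sub>R \<zeta> (r / 2)) = sin (r / 2) *\<^sub>R (\<zeta> 0 + \<zeta> r)"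
      by simp
    moreover have "sin (r / 2) > 0" using that by (intro sin_gt_zero) auto
    ultimately show ?thesis by (metis less_irrefl scaleR_cancel_left)
  qed
  have "c \<ge> 0" using g(3) by (simp add: unit_speed_geodesic_def)
  then have "\<gamma> 0 \<bullet> \<eta> 0 = 1" "\<gamma> 0 \<bullet> \<eta> b = cos b" "\<gamma> a \<bullet> \<eta> 0 = cos a" "\<gamma> a \<bullet> \<eta> b = cos c"
    using sphere_geodesic_inner[OF g(1), of 0 0] sphere_geodesic_inner[OF g(2), of 0 b]
      sphere_geodesic_inner[OF g(1), of a 0] sphere_geodesic_inner[OF g(3), of 0 c] assms e
    by auto
  moreover have "cos c = cos (a + b)"
  proof -
    have "c = 2 * pi - (a + b)" using assms by simp
    then show ?thesis by (simp add: cos_diff)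
  qed
  ultimately have "(4 * cos (a / 2) * cos (b / 2)) * (\<gamma> (a / 2) \<bullet> \<eta> (b / 2))
      = 1 + cos b + cos a + cos (a + b)"
    using arg_cong2[OF mid[OF g(1)] mid[OF g(2)], of inner] assms
    by (simp add: inner_add_left inner_add_right mult.assoc mult.left_commute)
  also have "\<dots> = (4 * cos (a / 2) * cos (b / 2)) * cos ((a + b) / 2)"
    using cos_plus_cos[of a b] cos_double_cos[of "(a + b) / 2"] cos_times_cos[of "a/2" "b/2"]
    by (simp add: power2_eq_square add_divide_distrib diff_divide_distrib algebra_simps)
  finally have "\<gamma> (a / 2) \<bullet> \<eta> (b / 2) = cos ((a + b) / 2)"
    using cos_gt_zero_pi[of "a / 2"] cos_gt_zero_pi[of "b / 2"] assms by simp
  moreover have "arccos (cos ((a + b) / 2)) = (a + b) / 2"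
    using assms by (intro arccos_cos) auto
  ultimately show ?thesis by (simp add: dist_S2_def)
qed

section \<open>Geodesics of a metric space\<close>

lemma geodesicD:
  assumes "unit_speed_geodesic UNIV dist a \<gamma>" "0 \<le> s" "s \<le> a" "0 \<le> t" "t \<le> a"
  shows "dist (\<gamma> s) (\<gamma> t) = \<bar>s - t\<bar>"
  using assms by (auto simp: unit_speed_geodesic_def)

lemma geodesic_joining:
  fixes x y :: "'a::metric_space"
  assumes "geodesic_space TYPE('a)"
  obtains \<gamma> where "unit_speed_geodesic UNIV dist (dist x y) \<gamma>" "\<gamma> 0 = x" "\<gamma> (dist x y) = y"
proof -
  obtain a \<gamma> where g: "unit_speed_geodesic UNIV dist a \<gamma>" "\<gamma> 0 = x" "\<gamma> a = y"
    using assms unfolding geodesic_space_def by blast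
  moreover have "dist x y = a"
    using geodesicD[OF g(1), of 0 a] g by (auto simp: unit_speed_geodesic_def)
  ultimately show ?thesis using that by blast
qed

lemma geodesic_joining_through:
  fixes p q r :: "'a::metric_space"
  assumes "geodesic_space TYPE('a)" "dist p r = dist p q + dist q r"
  obtains \<gamma> where "unit_speed_geodesic UNIV dist (dist p r) \<gamma>"
    "\<gamma> 0 = p" "\<gamma> (dist p q) = q" "\<gamma> (dist p r) = r"
proof -
  obtain \<alpha> where \<alpha>: "unit_speed_geodesic UNIV dist (dist p q) \<alpha>" "\<alpha> 0 = p" "\<alpha> (dist p q) = q"
    by (rule geodesic_joining[OF assms(1)])
  obtain \<beta> where \<beta>: "unit_speed_geodesic UNIV dist (dist q r) \<beta>" "\<beta> 0 = q" "\<beta> (dist q r) = r"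
    by (rule geodesic_joining[OF assms(1)])
  define \<gamma> where "\<gamma> t = (if t \<le> dist p q then \<alpha> t else \<beta> (t - dist p q))" for t
  \<comment> \<open>The path through \<open>q\<close> bounds the distance from above; a shortcut
    would bring \<open>p\<close> and \<open>r\<close> closer than assumed.\<close>
  have across: "dist (\<alpha> s) (\<beta> t) = dist p q - s + t"
    if "0 \<le> s" "s \<le> dist p q" "0 \<le> t" "t \<le> dist q r" for s t
  proof -
    have "dist p (\<alpha> s) = s" "dist (\<alpha> s) q = dist p q - s"
      using geodesicD[OF \<alpha>(1), of 0 s] geodesicD[OF \<alpha>(1), of s "dist p q"] \<alpha> that by auto
    moreover have "dist q (\<beta> t) = t" "dist (\<beta> t) r = dist q r - t"
      using geodesicD[OF \<beta>(1), of 0 t] geodesicD[OF \<beta>(1), of t "dist q r"] \<beta> that by auto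
    ultimately show ?thesis
      using dist_triangle[of p r "\<alpha> s"] dist_triangle[of "\<alpha> s" r "\<beta> t"]
        dist_triangle[of "\<alpha> s" "\<beta> t" q] assms(2) by linarith
  qed
  have "dist (\<gamma> s) (\<gamma> t) = t - s" if "0 \<le> s" "s \<le> t" "t \<le> dist p r" for s t
    using that assms(2) geodesicD[OF \<alpha>(1), of s t] across[of s "t - dist p q"]
      geodesicD[OF \<beta>(1), of "s - dist p q" "t - dist p q"]
    unfolding \<gamma>_def by auto
  then have "dist (\<gamma> s) (\<gamma> t) = \<bar>s - t\<bar>" if "s \<in> {0..dist p r}" "t \<in> {0..dist p r}" for s t
    using that by (cases "s \<le> t") (simp, simp add: dist_commute[of "\<gamma> s" "\<gamma> t"])
  then have "unit_speed_geodesic UNIV dist (dist p r) \<gamma>"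
    by (simp add: unit_speed_geodesic_def)
  moreover have "\<gamma> (dist p r) = r"
    using assms(2) \<alpha>(3) \<beta>(2,3) by (cases "q = r") (auto simp: \<gamma>_def)
  ultimately show ?thesis using that \<alpha> by (auto simp: \<gamma>_def)
qed

lemma geodesic_reverse:
  assumes "unit_speed_geodesic UNIV dist a \<gamma>"
  shows "unit_speed_geodesic UNIV dist a (\<lambda>t. \<gamma> (a - t))"
  using assms by (auto simp: unit_speed_geodesic_def)

section \<open>Consequences of the curvature bound\<close>

text \<open>Geodesics from \<open>p\<close> through \<open>q\<close> to \<open>r\<close> and
  \<open>r'\<close> are equal sides meeting at parameter \<open>dist p q\<close>. The comparison
  sides then meet there too and, on the sphere, end at the same point. The bound
  \<open>pi / 2\<close> provides the comparison triangle and keeps its base shorter than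
  \<open>pi\<close>.\<close>

lemma geodesics_do_not_branch:
  fixes p q r r' :: "'a::metric_space"
  assumes geo: "geodesic_space TYPE('a)" and curv: "busemann_curvature_ge_1 TYPE('a)"
    and "p \<noteq> q" "dist p r < pi / 2" "dist q r = dist q r'"
    and r: "dist p r = dist p q + dist q r" and r': "dist p r' = dist p q + dist q r'"
  shows "r = r'"
proof (rule ccontr)
  assume "r \<noteq> r'"
  define L c where "L = dist p r" and "c = dist r r'"
  have L': "dist p r' = L" using assms by (simp add: L_def)
  obtain \<gamma> where \<gamma>: "unit_speed_geodesic UNIV dist L \<gamma>" "\<gamma> 0 = p" "\<gamma> (dist p q) = q" "\<gamma> L = r"
    using geodesic_joining_through[OF geo r] unfolding L_def by blast
  obtain \<eta> where \<eta>: "unit_speed_geodesic UNIV dist L \<eta>" "\<eta> 0 = p" "\<eta> (dist p q) = q" "\<eta> L = r'"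
    using geodesic_joining_through[OF geo r'] unfolding L' by blast
  obtain \<xi> where \<xi>: "unit_speed_geodesic UNIV dist c \<xi>" "\<xi> 0 = r" "\<xi> c = r'"
    using geodesic_joining[OF geo, of r r'] unfolding c_def by blast
  have "0 < dist p q" "dist p q \<le> L" using assms by (auto simp: L_def)
  then have "0 < L" by linarith
  have "L < pi / 2" using assms(4) by (simp add: L_def)
  have "0 < c" "c \<le> 2 * L"
    using \<open>r \<noteq> r'\<close> L' dist_triangle2[of r r' p] by (auto simp: c_def L_def dist_commute)
  then have "\<exists>\<gamma> \<eta> \<xi>. geodesic_triangle S2 dist_S2 L L c \<gamma> \<eta> \<xi>"
    using isosceles_comparison_triangle_exists \<open>0 < L\<close> \<open>L < pi / 2\<close> by blast
  moreover have "geodesic_triangle UNIV dist L L c \<gamma> \<eta> \<xi>"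
    using \<gamma> \<eta> \<xi> by (simp add: geodesic_triangle_def)
  ultimately obtain \<gamma>' \<eta>' \<xi>' where T: "geodesic_triangle S2 dist_S2 L L c \<gamma>' \<eta>' \<xi>'"
    and le: "\<forall>t\<in>{0..1}. dist (\<gamma> (t * L)) (\<eta> (t * L)) \<ge> dist_S2 (\<gamma>' (t * L)) (\<eta>' (t * L))"
    using curv unfolding busemann_curvature_ge_1_def by blast
  have U: "unit_speed_geodesic S2 dist_S2 L \<gamma>'" "unit_speed_geodesic S2 dist_S2 L \<eta>'"
    "unit_speed_geodesic S2 dist_S2 c \<xi>'" "\<gamma>' 0 = \<eta>' 0" "\<gamma>' L = \<xi>' 0" "\<eta>' L = \<xi>' c"
    using T by (auto simp: geodesic_triangle_def)
  let ?s = "dist p q"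
  have s: "?s \<in> {0..L}" using \<open>?s \<le> L\<close> by simp
  have "?s / L \<in> {0..1}" "?s / L * L = ?s" using \<open>0 < L\<close> \<open>?s \<le> L\<close> by auto
  then have "dist_S2 (\<gamma>' ?s) (\<eta>' ?s) \<le> 0"
    using le[rule_format, of "?s / L"] \<gamma>(3) \<eta>(3) by simp
  moreover have S: "\<gamma>' ?s \<in> S2" "\<eta>' ?s \<in> S2"
    using U s by (auto simp: unit_speed_geodesic_def)
  then have "norm (\<gamma>' ?s) = 1" "norm (\<eta>' ?s) = 1" by (auto simp: S2_def)
  moreover from this have "\<bar>\<gamma>' ?s \<bullet> \<eta>' ?s\<bar> \<le> 1"
    using Cauchy_Schwarz_ineq2[of "\<gamma>' ?s" "\<eta>' ?s"] by simp
  ultimately have "\<gamma>' ?s \<bullet> \<eta>' ?s = 1"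
    using arccos_lbound[of "\<gamma>' ?s \<bullet> \<eta>' ?s"] cos_arccos_abs[of "\<gamma>' ?s \<bullet> \<eta>' ?s"]
    by (simp add: dist_S2_def)
  then have "norm (\<gamma>' ?s - \<eta>' ?s) ^ 2 = 0"
    using \<open>norm (\<gamma>' ?s) = 1\<close> \<open>norm (\<eta>' ?s) = 1\<close>
    unfolding power2_norm_eq_inner norm_eq_1
    by (simp add: inner_diff_left inner_diff_right inner_commute)
  then have "\<gamma>' ?s = \<eta>' ?s" by simp
  then have "\<xi>' 0 = \<xi>' c"
    using sphere_geodesic_unique[OF U(1,2) s \<open>0 < ?s\<close>] \<open>?s \<le> L\<close> \<open>L < pi / 2\<close> pi_gt_zero U(4-6)
    by simp
  \<comment> \<open>A base of length strictly between 0 and \<open>pi\<close> cannot have equal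
    ends.\<close>
  then have "cos 0 = cos c"
    using sphere_geodesic_inner[OF U(3), of 0 0] sphere_geodesic_inner[OF U(3), of 0 c] \<open>0 < c\<close>
    by simp
  moreover have "cos c < cos 0"
    using \<open>0 < c\<close> \<open>c \<le> 2 * L\<close> \<open>L < pi / 2\<close> by (intro cos_monotone_0_pi) auto
  ultimately show False by simp
qed

text \<open>The curvature bound at \<open>t = 1 / 2\<close>. It supplies only some comparison
  triangle, but the midpoint distance is the same in all of them.\<close>

lemma midpoints_of_full_triangle:
  fixes \<gamma> \<eta> \<xi> :: "real \<Rightarrow> 'a::metric_space"
  assumes "busemann_curvature_ge_1 TYPE('a)" "geodesic_triangle UNIV dist a b c \<gamma> \<eta> \<xi>"
    and len: "0 < a" "a < pi" "0 < b" "b < pi" "0 < c" "c < pi" "a + b + c = 2 * pi"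
  shows "dist (\<gamma> (a / 2)) (\<eta> (b / 2)) \<ge> (a + b) / 2"
proof -
  obtain \<gamma>' \<eta>' \<xi>' where T: "geodesic_triangle S2 dist_S2 a b c \<gamma>' \<eta>' \<xi>'"
    and "\<forall>t\<in>{0..1}. dist (\<gamma> (t * a)) (\<eta> (t * b)) \<ge> dist_S2 (\<gamma>' (t * a)) (\<eta>' (t * b))"
    using assms(1,2) great_circle_triangle_exists[OF len]
    unfolding busemann_curvature_ge_1_def by blast
  from this(2)[rule_format, of "1 / 2"] show ?thesis
    using great_circle_midpoint_dist[OF T] len by simp
qed

text \<open>The margins of length \<open>\<delta>\<close> allow non-branching to be applied at
  \<open>g 0\<close> and \<open>g pi\<close>; \<open>\<delta> \<le> 1 / 4\<close> keeps the
  geodesics involved shorter than \<open>pi / 2\<close>.\<close>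

lemma no_long_geodesic:
  fixes g :: "real \<Rightarrow> 'a::metric_space"
  assumes geo: "geodesic_space TYPE('a)" and curv: "busemann_curvature_ge_1 TYPE('a)"
    and nod: "not_one_dimensional TYPE('a)"
    and \<delta>: "0 < \<delta>" "\<delta> \<le> 1 / 4"
    and g: "\<And>s t. s \<in> {- \<delta>..pi + \<delta>} \<Longrightarrow> t \<in> {- \<delta>..pi + \<delta>} \<Longrightarrow> dist (g s) (g t) = \<bar>s - t\<bar>"
  shows False
proof -
  have pi3: "pi > 3" by (rule pi_gt3)
  have "unit_speed_geodesic UNIV dist pi g"
    using g \<delta> pi3 by (auto simp: unit_speed_geodesic_def)
  \<comment> \<open>Choosing \<open>\<epsilon> = \<delta>\<close> forces
    \<open>b > pi - \<delta>\<close>.\<close>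
  then obtain y where y: "dist (g 0) y < pi" "dist (g pi) y < \<delta>" "y \<notin> g ` {0..pi}"
    using nod \<delta> unfolding not_one_dimensional_def by (metis mem_ball pi_gt_zero)
  define b where "b = dist (g 0) y"
  define f where "f a = a + b + dist (g a) y" for a
  have "pi - \<delta> < b"
    using dist_triangle2[of "g 0" "g pi" y] y g[of 0 pi] \<delta> pi3 by (simp add: b_def)
  have b: "0 < b" "b < pi" using \<open>pi - \<delta> < b\<close> pi3 \<delta> y by (auto simp: b_def)
  have lip: "dist (g t) y \<le> dist (g s) y + (t - s)" if "0 \<le> s" "s \<le> t" "t \<le> pi" for s t
  proof -
    have "dist (g s) (g t) = t - s" using g[of s t] that \<delta> by simp
    then show ?thesis using dist_triangle3[of "g t" y "g s"] by simp
  qed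
  \<comment> \<open>\<open>f\<close> is the perimeter. Its sublevel set is compact and contains
    \<open>pi - b\<close>, so it has a largest element; that element being at least
    \<open>pi - b\<close> later yields \<open>c \<le> pi\<close>.\<close>
  define A where "A = {a \<in> {0..pi}. f a \<le> 2 * pi}"
  have "dist (g s) (g t) \<le> 1 * dist s t" if "s \<in> {0..pi}" "t \<in> {0..pi}" for s t
    using g[of s t] that \<delta> pi3 by (simp add: dist_real_def)
  then have "continuous_on {0..pi} g"
    by (rule lipschitz_on_continuous_on[OF lipschitz_onI[where L = 1]]) auto
  then have "continuous_on {0..pi} f" unfolding f_def[abs_def] by (intro continuous_intros)
  then have "closedin (top_of_set {0..pi}) ({0..pi} \<inter> f -` {..2 * pi})"
    by (rule continuous_closedin_preimage) simp
  moreover have "{0..pi} \<inter> f -` {..2 * pi} = A" by (auto simp: A_def)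
  ultimately have "compact A" using closedin_compact by force
  moreover have "pi - b \<in> A"
    using lip[of 0 "pi - b"] b by (auto simp: A_def f_def b_def)
  ultimately obtain a where "a \<in> A" and amax: "\<And>t. t \<in> A \<Longrightarrow> t \<le> a"
    using compact_attains_sup[of A] by blast
  then have a: "pi - b \<le> a" "a \<le> pi" "f a \<le> 2 * pi" "0 < a"
    using amax[OF \<open>pi - b \<in> A\<close>] b by (auto simp: A_def)
  have fa: "f a = 2 * pi"
  proof (rule antisym)
    show "2 * pi \<le> f a"
    proof (cases "a = pi")
      case True
      then show ?thesis
        using dist_triangle2[of "g 0" "g pi" y] g[of 0 pi] \<delta> pi3 True by (simp add: f_def b_def)
    next
      case False
      \<comment> \<open>The perimeter grows at rate at most 2, so advancing by half the missing
        amount stays in \<open>A\<close>.\<close>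
      define t where "t = min pi (a + (2 * pi - f a) / 2)"
      have t: "a \<le> t" "t \<le> pi" "2 * (t - a) \<le> 2 * pi - f a" using a by (simp_all add: t_def min_def field_simps)
      moreover have "dist (g t) y \<le> dist (g a) y + (t - a)" using t a by (intro lip) auto
      ultimately have "f t \<le> 2 * pi" unfolding f_def by argo
      then have "t \<le> a" using amax[of t] t a by (simp add: A_def)
      then show ?thesis using a False by (simp add: t_def min_def field_simps split: if_splits)
    qed
  qed (rule a)
  define c where "c = dist (g a) y"
  have c: "0 < c" "a + b + c = 2 * pi"
  proof -
    have "g a \<in> g ` {0..pi}" using a by (intro imageI) simp
    then have "g a \<noteq> y" using y(3) by blast
    then show "0 < c" by (simp add: c_def)
    show "a + b + c = 2 * pi" using fa by (simp add: f_def c_def)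
  qed
  obtain \<eta> where \<eta>: "unit_speed_geodesic UNIV dist b \<eta>" "\<eta> 0 = g 0" "\<eta> b = y"
    using geodesic_joining[OF geo, of "g 0" y] unfolding b_def by blast
  consider "a = pi" | "a + b = pi" "a < pi" | "a < pi" "pi < a + b" using a by linarith
  then show False
  proof cases
    \<comment> \<open>Here \<open>b + c = pi\<close>. Running backwards from
      \<open>g (pi + \<delta>)\<close>, both \<open>y\<close> and \<open>g (pi - c)\<close> continue
      the geodesic beyond \<open>g pi\<close>.\<close>
    case 1
    let ?p = "g (pi + \<delta>)" and ?q = "g pi"
    have "c < \<delta>" using 1 y by (simp add: c_def)
    have q: "dist ?p ?q = \<delta>" "dist ?q y = c" using g[of "pi + \<delta>" pi] \<delta> 1 pi3 by (auto simp: c_def)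
    have r': "dist ?p (g (pi - c)) = \<delta> + c" "dist ?q (g (pi - c)) = c"
      using g[of "pi + \<delta>" "pi - c"] g[of pi "pi - c"] \<open>c < \<delta>\<close> c \<delta> pi3 by auto
    have "dist ?p (g 0) = pi + \<delta>" using g[of "pi + \<delta>" 0] \<delta> pi3 by simp
    then have r: "dist ?p y = \<delta> + c"
      using dist_triangle2[of ?p "g 0" y] dist_triangle[of ?p y ?q] q 1 c by (simp add: b_def)
    have "y = g (pi - c)"
      by (rule geodesics_do_not_branch[OF geo curv, of ?p ?q])
        (use q r r' \<delta> \<open>c < \<delta>\<close> pi3 in auto)
    then show False using y(3) \<open>c < \<delta>\<close> c \<delta> pi3 by auto
  next
    \<comment> \<open>Here \<open>c = pi = a + b\<close>, so \<open>\<eta>\<close> prolongs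
      \<open>g\<close> backwards beyond \<open>g 0\<close> and must agree with
      \<open>g (- \<delta>)\<close>.\<close>
    case 2
    define l where "l = min a (1 / 4)"
    have l: "0 < l" "l \<le> a" "l \<le> 1 / 4" using a by (auto simp: l_def)
    let ?p = "g l" and ?q = "g 0" and ?r = "\<eta> \<delta>"
    have "\<delta> \<le> b" using \<open>pi - \<delta> < b\<close> \<delta> pi3 by simp
    then have r: "dist ?q ?r = \<delta>" "dist ?r y = b - \<delta>"
      using geodesicD[OF \<eta>(1), of 0 \<delta>] geodesicD[OF \<eta>(1), of \<delta> b] \<eta> \<delta> by auto
    have q: "dist ?p ?q = l" "dist (g a) ?p = a - l"
      using g[of l 0] g[of a l] l a \<delta> pi3 by auto
    have pr: "dist ?p ?r = l + \<delta>"
      using dist_triangle[of "g a" y ?p] dist_triangle[of ?p y ?r] dist_triangle[of ?p ?r ?q]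
        q r 2 c c_def by linarith
    have r': "dist ?p (g (- \<delta>)) = l + \<delta>" "dist ?q (g (- \<delta>)) = \<delta>"
      using g[of l "- \<delta>"] g[of 0 "- \<delta>"] l a \<delta> pi3 by auto
    have "?r = g (- \<delta>)"
      by (rule geodesics_do_not_branch[OF geo curv, of ?p ?q])
        (use q r r' pr \<delta> l pi3 in auto)
    moreover have "dist (g pi) (g (- \<delta>)) = pi + \<delta>" using g[of pi "- \<delta>"] \<delta> pi3 by simp
    \<comment> \<open>Passing through \<open>y\<close>, the distance from \<open>g pi\<close> to
      \<open>?r\<close> is less than \<open>\<delta> + (b - \<delta>) < pi\<close>.\<close>
    ultimately show False
      using dist_triangle2[of "g pi" ?r y] r y(2) b \<delta>(1) by simp
  next
    case 3
    obtain \<xi> where \<xi>: "unit_speed_geodesic UNIV dist c \<xi>" "\<xi> 0 = g a" "\<xi> c = y"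
      using geodesic_joining[OF geo, of "g a" y] unfolding c_def by blast
    have "unit_speed_geodesic UNIV dist a g"
      using g a \<delta> pi3 by (auto simp: unit_speed_geodesic_def)
    \<comment> \<open>Now all sides are shorter than \<open>pi\<close>. Reversing \<open>g\<close>
      makes \<open>g a\<close> the vertex from which the two compared sides start.\<close>
    from geodesic_reverse[OF this]
    have T: "geodesic_triangle UNIV dist a c b (\<lambda>t. g (a - t)) \<xi> \<eta>"
      using \<xi> \<eta> by (simp add: geodesic_triangle_def)
    have mid: "dist (g (a / 2)) (\<xi> (c / 2)) \<ge> (a + c) / 2"
      using midpoints_of_full_triangle[OF curv T] a b c 3 by simp
    \<comment> \<open>The points stay between the two midpoints, \<open>a + s\<close> stays within
      \<open>{0..pi}\<close>, and the caps \<open>1 / 4\<close> allow non-branching.\<close>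
    define l s where "l = min (a / 2) (1 / 4)" and "s = min (c / 2) (min (pi - a) (1 / 4))"
    have l: "0 < l" "l \<le> a / 2" "l \<le> 1 / 4" using a by (auto simp: l_def)
    have s: "0 < s" "s \<le> c / 2" "s \<le> pi - a" "s \<le> 1 / 4" using 3 c by (simp_all add: s_def min_def)
    let ?p = "g (a - l)" and ?q = "g a" and ?r = "\<xi> s"
    have r: "dist ?q ?r = s" "dist ?r (\<xi> (c / 2)) = c / 2 - s" "dist ?r y = c - s"
      using geodesicD[OF \<xi>(1), of 0 s] geodesicD[OF \<xi>(1), of s "c / 2"]
        geodesicD[OF \<xi>(1), of s c] \<xi> s by auto
    have q: "dist ?p ?q = l" "dist (g (a / 2)) ?p = a / 2 - l"
      using g[of "a - l" a] g[of "a / 2" "a - l"] l a \<delta> pi3 by auto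
    \<comment> \<open>The midpoint bound makes the path along \<open>g\<close> to \<open>g a\<close>
      and on along \<open>\<xi>\<close> minimising between the midpoints, hence also between
      \<open>?p\<close> and \<open>?r\<close>.\<close>
    have pr: "dist ?p ?r = l + s"
      using dist_triangle[of "g (a / 2)" "\<xi> (c / 2)" ?p] dist_triangle[of ?p "\<xi> (c / 2)" ?r]
        dist_triangle[of ?p ?r ?q] q r mid by argo
    have r': "dist ?p (g (a + s)) = l + s" "dist ?q (g (a + s)) = s"
      using g[of "a - l" "a + s"] g[of a "a + s"] l s a \<delta> pi3 by auto
    have "?r = g (a + s)"
      by (rule geodesics_do_not_branch[OF geo curv, of ?p ?q])
        (use q r r' pr l s pi3 in auto)
    then have "f (a + s) = 2 * pi" using r c by (simp add: f_def)
    then have "a + s \<in> A" using a s by (simp add: A_def)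
    then show False using amax[of "a + s"] s by simp
  qed
qed

theorem theorem2p28:
  assumes "complete (UNIV :: 'a::metric_space set)"
    and "proper_space TYPE('a)"
    and "geodesic_space TYPE('a)"
    and "busemann_curvature_ge_1 TYPE('a)"
    and "not_one_dimensional TYPE('a)"
  shows "bounded (UNIV :: 'a set) \<and> diameter (UNIV :: 'a set) \<le> pi"
proof -
  have le: "dist x y \<le> pi" for x y :: 'a
  proof (rule ccontr)
    assume "\<not> dist x y \<le> pi"
    obtain \<gamma> where \<gamma>: "unit_speed_geodesic UNIV dist (dist x y) \<gamma>"
      "\<gamma> 0 = x" "\<gamma> (dist x y) = y"
      by (rule geodesic_joining[OF assms(3)])
    \<comment> \<open>Half the excess over \<open>pi\<close> is left at either end once the
      parameter is shifted by \<open>\<delta>\<close>.\<close>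
    define \<delta> where "\<delta> = min ((dist x y - pi) / 2) (1 / 4)"
    have \<delta>: "0 < \<delta>" "\<delta> \<le> 1 / 4" "pi + 2 * \<delta> \<le> dist x y"
      using \<open>\<not> dist x y \<le> pi\<close> by (simp_all add: \<delta>_def min_def field_simps)
    have "dist (\<gamma> (s + \<delta>)) (\<gamma> (t + \<delta>)) = \<bar>s - t\<bar>"
      if "s \<in> {- \<delta>..pi + \<delta>}" "t \<in> {- \<delta>..pi + \<delta>}" for s t
      using geodesicD[OF \<gamma>(1), of "s + \<delta>" "t + \<delta>"] that \<delta>(3) by simp
    then show False
      by (rule no_long_geodesic[OF assms(3-5) \<delta>(1,2), of "\<lambda>t. \<gamma> (t + \<delta>)"])
  qed
  then have "bounded (UNIV :: 'a set)" unfolding bounded_def by blast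
  moreover have "diameter (UNIV :: 'a set) \<le> pi"
  proof -
    have "(SUP (x, y)\<in>(UNIV :: 'a set) \<times> UNIV. dist x y) \<le> pi"
      by (rule cSUP_least) (use le in \<open>simp_all add: case_prod_beta\<close>)
    then show ?thesis by (simp add: diameter_def)
  qed
  ultimately show ?thesis ..
qed

end
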